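(* Let $n\ge 1$, let $t,a,b,c,d$ be parameters of modulus less than $1$, and let $\lambda$ be a partition with $l(\lambda)\le n$. Then $$\langle E_{\lambda}^{(n)}(z;c,d), E_{\lambda}^{(n)}(z;c,d) \rangle_{0} = \langle E_{\lambda}^{(n)}(z;c,d), z^{\lambda} \rangle_{0} =\prod_{i=0}^{m_{0}(\lambda)-1} \frac{1}{(1-t^{i}ac)(1-t^{i}bc)(1-t^{i}cd)(1-t^{i}ad)(1-t^{i}bd)} \prod_{j=m_{0}(\lambda)-1}^{2m_{0}(\lambda)-2} (1-t^{j}abcd),$$ where empty products (the case $m_0(\lambda)=0$) equal $1$.
   Context: A partition $\lambda=(\lambda_1,\dots,\lambda_n)$ with $l(\lambda)\le n$ is a non-increasing string of $n$ non-negative integers (zeros allowed), $l(\lambda)$ being the number of nonzero parts and $m_0(\lambda)=n-l(\lambda)$ the number of zero parts. Write $z^\mu=z_1^{\mu_1}\cdots z_n^{\mu_n}$ for $\mu\in\mathbb{Z}^n$. For a partition $\lambda$ with $l(\lambda)\le n$, $E_{\lambda}^{(n)}(z;c,d) = \prod_{i:\,\lambda_{i} > 0} z_{i}^{\lambda_{i}} (1-cz_{i}^{-1})(1-dz_{i}^{-1})$. $T=\{(z_1,\dots,z_n):|z_1|=\dots=|z_n|=1\}$, $dT=\prod_{j=1}^n\frac{dz_j}{2\pi\sqrt{-1}\,z_j}$, and $$\langle f,g \rangle_{0} = \int_{T} f\, \bar{g}^{\iota}\, \Delta_{K}^{(n)}(z;t;a,b,c,d)\, dT,$$ $$\Delta_{K}^{(n)}(z;t;a,b,c,d)=\prod_{1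 \leq i \leq n} \frac{(1-z_{i}^{2})}{(1-az_{i})(1-bz_{i})(1-cz_{i})(1-dz_{i})(1-cz_{i}^{-1})(1-dz_{i}^{-1})} \prod_{1 \leq i<j \leq n} \frac{1-z_{i}z_{j}^{\pm 1}}{1-tz_{i}z_{j}^{\pm 1}},$$ where $1-xz_j^{\pm1}$ stands for $(1-xz_j)(1-xz_j^{-1})$. Here $\bar{\phantom{g}}$ is the involution $z^\nu\mapsto z^{-\nu}$ fixing the parameters, and $\iota$ is the involution inverting each parameter ($t\to t^{-1}$, $a\to a^{-1}$, $b\to b^{-1}$, $c\to c^{-1}$, $d\to d^{-1}$) in the coefficients of a Laurent polynomial $g$ (regarded as rational functions of the parameters) and fixing each $z^\nu$; it is applied to $g$ only, and the resulting expression is evaluated at parameter values where it is defined. E.g. $\overline{z^\lambda}^{\,\iota}=z^{-\lambda}$, and $\overline{E_\lambda^{(n)}}^{\,\iota}=\prod_{i:\lambda_i>0}z_i^{-\lambda_i}(1-c^{-1}z_i)(1-d^{-1}z_i)$. *)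

theory Defs
  imports "HOL-Analysis.Analysis"
begin

text \<open>
  The variables are a family \<open>z :: nat \<Rightarrow> complex\<close>, of which only \<open>z 1, \<dots>, z n\<close> matter; in the same way a
  partition with at most \<open>n\<close> nonzero parts is a function on \<open>{1..n}\<close>.
\<close>

definition is_partition :: "nat \<Rightarrow> (nat \<Rightarrow> nat) \<Rightarrow> bool" where
  "is_partition n \<mu> \<longleftrightarrow> (\<forall>i\<in>{1..n}. \<forall>j\<in>{1..n}. i \<le> j \<longrightarrow> \<mu> j \<le> \<mu> i)"

definition part_length :: "nat \<Rightarrow> (nat \<Rightarrow> nat) \<Rightarrow> nat" where
  "part_length n \<mu> = card {i\<in>{1..n}. \<mu> i > 0}"

definition zero_parts :: "nat \<Rightarrow> (nat \<Rightarrow> nat) \<Rightarrow> nat" where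
  "zero_parts n \<mu> = n - part_length n \<mu>"

definition zmonom :: "nat \<Rightarrow> (nat \<Rightarrow> int) \<Rightarrow> (nat \<Rightarrow> complex) \<Rightarrow> complex" where
  "zmonom n \<mu> z = (\<Prod>i = 1..n. z i powi \<mu> i)"

definition E_poly :: "nat \<Rightarrow> (nat \<Rightarrow> nat) \<Rightarrow> complex \<Rightarrow> complex \<Rightarrow> (nat \<Rightarrow> complex) \<Rightarrow> complex" where
  "E_poly n \<mu> c d z =
     (\<Prod>i | i \<in> {1..n} \<and> \<mu> i > 0. z i ^ \<mu> i * (1 - c * inverse (z i)) * (1 - d * inverse (z i)))"

definition Delta_K ::
    "nat \<Rightarrow> complex \<Rightarrow> complex \<Rightarrow> complex \<Rightarrow> complex \<Rightarrow> complex \<Rightarrow> (nat \<Rightarrow> complex) \<Rightarrow> complex" where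
  "Delta_K n t a b c d z =
     (\<Prod>i = 1..n. (1 - (z i)\<^sup>2) /
        ((1 - a * z i) * (1 - b * z i) * (1 - c * z i) * (1 - d * z i) *
         (1 - c * inverse (z i)) * (1 - d * inverse (z i)))) *
     (\<Prod>(i, j) | 1 \<le> i \<and> i < j \<and> j \<le> n.
        ((1 - z i * z j) * (1 - z i * inverse (z j))) /
        ((1 - t * z i * z j) * (1 - t * z i * inverse (z j))))"

text \<open>
  A Laurent polynomial in \<open>z\<close> with coefficients rational in the parameters is represented by the
  function it induces of the parameter tuple \<open>(t, a, b, c, d)\<close> and of \<open>z\<close>. On such functions the two
  involutions are substitutions. At a tuple \<open>p\<close> with a zero entry, \<open>param_inv g p\<close> is the value of
  \<open>g\<close> with its parameters inverted only if \<open>g\<close> does not involve the vanishing parameters, because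
  \<open>inverse 0 = 0\<close>.
\<close>

type_synonym params = "complex \<times> complex \<times> complex \<times> complex \<times> complex"
type_synonym laurent_fun = "params \<Rightarrow> (nat \<Rightarrow> complex) \<Rightarrow> complex"

definition bar_inv :: "laurent_fun \<Rightarrow> laurent_fun" where
  "bar_inv g = (\<lambda>p z. g p (\<lambda>i. inverse (z i)))"

definition param_inv :: "laurent_fun \<Rightarrow> laurent_fun" where
  "param_inv g = (\<lambda>(t, a, b, c, d). g (inverse t, inverse a, inverse b, inverse c, inverse d))"

text \<open>
  Integration over the torus \<open>T\<close> against \<open>dT\<close>: the parametrisation \<open>z\<^sub>j = exp (2 \<pi> \<i> \<theta>\<^sub>j)\<close> with
  \<open>0 \<le> \<theta>\<^sub>j \<le> 1\<close> turns \<open>dz\<^sub>j / (2 \<pi> \<i> z\<^sub>j)\<close> into \<open>d\<theta>\<^sub>j\<close>.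
\<close>

definition torus_integral :: "nat \<Rightarrow> ((nat \<Rightarrow> complex) \<Rightarrow> complex) \<Rightarrow> complex" where
  "torus_integral n F =
     (LINT \<theta> : (\<Pi>\<^sub>E j\<in>{1..n}. {0..1}) | (\<Pi>\<^sub>M j\<in>{1..n}. lborel).
        F (\<lambda>j. exp (2 * of_real pi * \<i> * of_real (\<theta> j))))"

definition inner0 :: "nat \<Rightarrow> params \<Rightarrow> laurent_fun \<Rightarrow> laurent_fun \<Rightarrow> complex" where
  "inner0 n p f g =
     (case p of (t, a, b, c, d) \<Rightarrow>
        torus_integral n (\<lambda>z. f p z * param_inv (bar_inv g) p z * Delta_K n t a b c d z))"

end

theory Submission
  imports Defs "HOL-Complex_Analysis.Complex_Analysis"
begin

text \<open>
  Once \<open>z\<^sub>1, \<dots>, z\<^sub>k\<^sub>-\<^sub>1\<close> have been integrated out, the denominator of the density involves \<open>z\<^sub>k\<close>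
  only in factors \<open>1 - s z\<^sub>k\<close> with \<open>\<bar>s\<bar> < 1\<close>, which have no zero in the closed unit disc, and in
  \<open>1 - c z\<^sub>k\<^sup>-\<^sup>1\<close> and \<open>1 - d z\<^sub>k\<^sup>-\<^sup>1\<close>. The integral is therefore computed one variable at a time, in
  increasing order of the index.

  If \<open>\<mu> k > 0\<close>, the factors of \<open>E\<close> cancel the two inner poles, and the power of \<open>z\<^sub>k\<close> cancels against
  the conjugated second argument. What is left is holomorphic in the disc and averages to its value
  at \<open>0\<close>, where everything that involves \<open>z\<^sub>k\<close> equals \<open>1\<close>; this holds for \<open>z\<^sup>\<mu>\<close> and for \<open>E\<close> as second
  argument alike. As \<open>\<mu>\<close> is a partition, its positive parts come first, so these variables disappear
  (\<open>torus_avg_density_leading_holomorphic\<close>) and the integral of the bare density in \<open>m\<close> variables,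
  \<open>I\<^sub>m(c, d)\<close>, remains.

  There the average over \<open>z\<^sub>k\<close> picks up the two poles \<open>c\<close> and \<open>d\<close>. At \<open>z\<^sub>k = c\<close> the interaction with
  a later variable \<open>y\<close> is \<open>(1 - c y) (1 - c y\<^sup>-\<^sup>1) / ((1 - t c y) (1 - t c y\<^sup>-\<^sup>1))\<close>, which
  exactly replaces \<open>c\<close> by \<open>t c\<close> in the weight of \<open>y\<close>. Hence, for \<open>c \<noteq> d\<close>, the integral \<open>I\<^sub>m(c, d)\<close> is the
  combination of \<open>I\<^sub>m\<^sub>-\<^sub>1(t c, d)\<close> and \<open>I\<^sub>m\<^sub>-\<^sub>1(c, t d)\<close> given in \<open>torus_avg_density_recursion\<close>. The
  product formula satisfies the same recursion (\<open>closed_form_recursion\<close>), which comes down to the identity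
  \<open>c (1 - T a d) (1 - T b d) - d (1 - T a c) (1 - T b c) = (c - d) (1 - T\<^sup>2 a b c d)\<close> with
  \<open>T = t\<^sup>m\<^sup>-\<^sup>1\<close>. The case \<open>c = d\<close>, which the inductive step also meets, follows by continuity
  in \<open>d\<close> (\<open>torus_avg_density_tendsto\<close>).
\<close>

section \<open>Averages over circles and tori\<close>

definition circ :: "real \<Rightarrow> complex" where
  "circ y = exp (2 * of_real pi * \<i> * of_real y)"

definition circle_avg :: "(complex \<Rightarrow> complex) \<Rightarrow> complex" where
  "circle_avg f = (LINT y : {0..1} | lborel. f (circ y))"

text \<open>
  The average over the torus with coordinates in an arbitrary finite set of indices, so that variables
  can be removed one at a time.
\<close>
definition torus_avg :: "nat set \<Rightarrow> ((nat \<Rightarrow> complex) \<Rightarrow> complex) \<Rightarrow> complex" where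
  "torus_avg K F =
     (LINT \<theta> : (\<Pi>\<^sub>E j\<in>K. {0..1}) | (\<Pi>\<^sub>M j\<in>K. lborel). F (\<lambda>j. circ (\<theta> j)))"

definition unimodular :: "(nat \<Rightarrow> complex) \<Rightarrow> bool" where
  "unimodular z \<longleftrightarrow> (\<forall>i. cmod (z i) = 1)"

text \<open>
  Measurability in the angles together with boundedness on the torus gives integrability on a box of
  volume \<open>1\<close>, and both pass to finite products. This settles the hypotheses of Fubini's theorem for
  all the integrands below.
\<close>
definition torus_regular :: "nat set \<Rightarrow> ((nat \<Rightarrow> complex) \<Rightarrow> complex) \<Rightarrow> bool" where
  "torus_regular K F \<longleftrightarrow>
     (\<lambda>\<theta>. F (\<lambda>j. circ (\<theta> j))) \<in> borel_measurable (\<Pi>\<^sub>M j\<in>K. lborel) \<and>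
     (\<exists>B. \<forall>z. unimodular z \<longrightarrow> cmod (F z) \<le> B)"

interpretation lebesgue_product: product_sigma_finite "\<lambda>_::nat. lborel :: real measure"
  by standard

lemma torus_integral_eq_torus_avg: "torus_integral n F = torus_avg {1..n} F"
  by (simp add: torus_integral_def torus_avg_def circ_def)

lemma norm_circ [simp]: "cmod (circ y) = 1"
  by (simp add: circ_def)

lemma continuous_circ: "continuous_on A circ"
  unfolding circ_def by (intro continuous_intros)

lemma unimodular_circ [simp]: "unimodular (\<lambda>j. circ (\<theta> j))"
  by (simp add: unimodular_def)

lemma circle_avg_cong:
  assumes "\<And>x. cmod x = 1 \<Longrightarrow> f x = g x"
  shows "circle_avg f = circle_avg g"
  unfolding circle_avg_def using assms by simp

lemma circle_avg_add:
  assumes "set_integrable lborel {0..1} (\<lambda>y. f (circ y))" "set_integrable lborel {0..1} (\<lambda>y. g (circ y))"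
  shows "circle_avg (\<lambda>x. \<alpha> * f x + \<beta> * g x) = \<alpha> * circle_avg f + \<beta> * circle_avg g"
  unfolding circle_avg_def using assms by (subst set_integral_add(2)) auto

lemma torus_avg_cong:
  assumes "\<And>z. unimodular z \<Longrightarrow> F z = G z"
  shows "torus_avg K F = torus_avg K G"
  unfolding torus_avg_def using assms by simp

lemma torus_avg_empty: "torus_avg {} F = F (\<lambda>_. circ undefined)"
  unfolding torus_avg_def set_lebesgue_integral_def
  by (simp add: PiM_empty lebesgue_integral_count_space_finite)

lemma torus_box_sets:
  fixes K :: "nat set"
  shows "finite K \<Longrightarrow> (\<Pi>\<^sub>E j\<in>K. {0..1::real}) \<in> sets (\<Pi>\<^sub>M j\<in>K. lborel)"
  by (intro sets_PiM_I_finite) auto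

lemma torus_box_emeasure:
  fixes K :: "nat set"
  shows "finite K \<Longrightarrow> emeasure (\<Pi>\<^sub>M j\<in>K. lborel) (\<Pi>\<^sub>E j\<in>K. {0..1::real}) = 1"
  using lebesgue_product.emeasure_PiM[of K "\<lambda>_. {0..1}"] by simp

lemma torus_regular_integrable:
  assumes "finite K" "torus_regular K F"
  shows "set_integrable (\<Pi>\<^sub>M j\<in>K. lborel) (\<Pi>\<^sub>E j\<in>K. {0..1}) (\<lambda>\<theta>. F (\<lambda>j. circ (\<theta> j)))"
proof -
  from assms obtain B where
    [measurable]: "(\<lambda>\<theta>. F (\<lambda>j. circ (\<theta> j))) \<in> borel_measurable (\<Pi>\<^sub>M j\<in>K. lborel)" and
    B: "\<And>z. unimodular z \<Longrightarrow> cmod (F z) \<le> B"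
    unfolding torus_regular_def by auto
  note [measurable] = torus_box_sets[OF assms(1)]
  show ?thesis
    unfolding set_integrable_def
    by (rule integrableI_bounded_set[where A = "\<Pi>\<^sub>E j\<in>K. {0..1}" and B = B])
       (use B in \<open>auto simp: torus_box_emeasure[OF assms(1)] indicator_def\<close>)
qed

lemma torus_regular_const: "torus_regular K (\<lambda>_. \<alpha>)"
  unfolding torus_regular_def by auto

lemma torus_regular_mult:
  assumes "torus_regular K F" "torus_regular K G"
  shows "torus_regular K (\<lambda>z. F z * G z)"
proof -
  from assms obtain A B where
    A: "\<And>z. unimodular z \<Longrightarrow> cmod (F z) \<le> A" and B: "\<And>z. unimodular z \<Longrightarrow> cmod (G z) \<le> B"
    unfolding torus_regular_def by auto
  have "cmod (F z * G z) \<le> A * B" if "unimodular z" for z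
    unfolding norm_mult using A[OF that] B[OF that]
    by (intro mult_mono) (auto intro: order_trans[OF norm_ge_zero])
  then show ?thesis
    using assms unfolding torus_regular_def by (auto intro!: borel_measurable_times)
qed

lemma torus_regular_prod:
  assumes "\<And>i. i \<in> I \<Longrightarrow> torus_regular K (F i)"
  shows "torus_regular K (\<lambda>z. \<Prod>i\<in>I. F i z)"
  using assms
  by (induction I rule: infinite_finite_induct)
     (auto intro: torus_regular_mult torus_regular_const)

text \<open>
  The torus \<open>sphere 0 1 \<times> sphere 0 1\<close> is compact, so continuity there gives the bound; continuity in the
  two angles gives measurability.
\<close>
lemma torus_regular_two_coordinates:
  fixes f :: "complex \<times> complex \<Rightarrow> complex"
  assumes f: "continuous_on (sphere 0 1 \<times> sphere 0 1) f" and ij: "i \<in> K" "j \<in> K"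
  shows "torus_regular K (\<lambda>z. f (z i, z j))"
  unfolding torus_regular_def
proof
  have "continuous_on UNIV (\<lambda>p :: real \<times> real. f (circ (fst p), circ (snd p)))"
    by (rule continuous_on_compose2[OF f])
       (auto intro!: continuous_intros continuous_on_compose2[OF continuous_circ[of UNIV]])
  then have [measurable]: "(\<lambda>p. f (circ (fst p), circ (snd p))) \<in> borel_measurable (borel \<Otimes>\<^sub>M borel)"
    by (subst borel_prod) (rule borel_measurable_continuous_onI)
  have [measurable]: "(\<lambda>\<theta>. \<theta> i) \<in> borel_measurable (\<Pi>\<^sub>M j\<in>K. lborel :: real measure)"
    "(\<lambda>\<theta>. \<theta> j) \<in> borel_measurable (\<Pi>\<^sub>M j\<in>K. lborel :: real measure)"
    using measurable_component_singleton[OF ij(1), of "\<lambda>_. lborel :: real measure"]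
      measurable_component_singleton[OF ij(2), of "\<lambda>_. lborel :: real measure"] by simp_all
  have "(\<lambda>\<theta>. (\<lambda>p. f (circ (fst p), circ (snd p))) (\<theta> i, \<theta> j))
          \<in> borel_measurable (\<Pi>\<^sub>M j\<in>K. lborel)"
    by (rule measurable_compose[of _ _ "borel \<Otimes>\<^sub>M borel"]) measurable
  then show "(\<lambda>\<theta>. f (circ (\<theta> i), circ (\<theta> j))) \<in> borel_measurable (\<Pi>\<^sub>M j\<in>K. lborel)"
    by simp
  have "bounded (f ` (sphere 0 1 \<times> sphere 0 1))"
    by (intro compact_imp_bounded compact_continuous_image f compact_Times compact_sphere)
  then obtain B where "\<And>p. p \<in> sphere 0 1 \<times> sphere 0 1 \<Longrightarrow> cmod (f p) \<le> B"
    unfolding bounded_iff by auto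
  then show "\<exists>B. \<forall>z. unimodular z \<longrightarrow> cmod (f (z i, z j)) \<le> B"
    by (auto simp: unimodular_def intro!: exI[of _ B])
qed

lemma torus_regular_coordinate:
  assumes "continuous_on (sphere 0 1) f" "i \<in> K"
  shows "torus_regular K (\<lambda>z. f (z i))"
proof -
  have "continuous_on (sphere 0 1 \<times> sphere 0 1) (\<lambda>p :: complex \<times> complex. f (fst p))"
    by (rule continuous_on_compose2[OF assms(1)]) (auto intro!: continuous_intros)
  from torus_regular_two_coordinates[OF this assms(2,2)] show ?thesis by simp
qed

lemma torus_avg_add:
  assumes "finite K" "torus_regular K F" "torus_regular K G"
  shows "torus_avg K (\<lambda>z. \<alpha> * F z + \<beta> * G z) = \<alpha> * torus_avg K F + \<beta> * torus_avg K G"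
  unfolding torus_avg_def
  using torus_regular_integrable[OF assms(1,2)] torus_regular_integrable[OF assms(1,3)]
  by (subst set_integral_add(2)) auto

lemma torus_avg_insert:
  assumes K: "finite K" "i \<notin> K" and F: "torus_regular (insert i K) F"
  shows "torus_avg (insert i K) F = torus_avg K (\<lambda>z. circle_avg (\<lambda>x. F (z(i := x))))"
proof -
  define B :: "nat set \<Rightarrow> (nat \<Rightarrow> real) set" where "B J = (\<Pi>\<^sub>E j\<in>J. {0..1})" for J
  have int: "integrable (\<Pi>\<^sub>M j\<in>insert i K. lborel)
      (\<lambda>\<theta>. indicator (B (insert i K)) \<theta> *\<^sub>R F (\<lambda>j. circ (\<theta> j)))"
    using torus_regular_integrable[OF _ F] K by (simp add: set_integrable_def B_def)
  have box: "indicator (B (insert i K)) (\<theta>(i := y)) = indicator (B K) \<theta> * (indicator {0..1} y :: real)"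
    if "\<theta> \<in> space (\<Pi>\<^sub>M j\<in>K. lborel :: real measure)" for \<theta> y
    using that K by (auto simp: B_def indicator_def PiE_iff space_PiM extensional_def)
  have upd: "(\<lambda>j. circ (if j = i then y else \<theta> j)) = (\<lambda>j. circ (\<theta> j))(i := circ y)" for \<theta> y
    by auto
  have "torus_avg (insert i K) F =
      (\<integral>\<theta>. (\<integral>y. indicator (B (insert i K)) (\<theta>(i := y)) *\<^sub>R
          F (\<lambda>j. circ ((\<theta>(i := y)) j)) \<partial>lborel) \<partial>(\<Pi>\<^sub>M j\<in>K. lborel))"
    unfolding torus_avg_def set_lebesgue_integral_def B_def[symmetric]
    by (rule lebesgue_product.product_integral_insert[OF K int])
  also have "\<dots> = (\<integral>\<theta>. indicator (B K) \<theta> *\<^sub>R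
      (\<integral>y. indicator {0..1} y *\<^sub>R F ((\<lambda>j. circ (\<theta> j))(i := circ y)) \<partial>lborel) \<partial>(\<Pi>\<^sub>M j\<in>K. lborel))"
    by (rule Bochner_Integration.integral_cong) (simp_all add: box upd flip: scaleR_scaleR)
  finally show ?thesis
    by (simp add: torus_avg_def circle_avg_def set_lebesgue_integral_def B_def)
qed

lemma torus_avg_tendsto:
  assumes K: "finite K"
    and F: "\<And>k. torus_regular K (F k)" and G: "torus_regular K G"
    and lim: "\<And>z. unimodular z \<Longrightarrow> (\<lambda>k. F k z) \<longlonglongrightarrow> G z"
    and bound: "\<And>k z. unimodular z \<Longrightarrow> cmod (F k z) \<le> B"
  shows "(\<lambda>k. torus_avg K (F k)) \<longlonglongrightarrow> torus_avg K G"
  unfolding torus_avg_def set_lebesgue_integral_def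
proof (rule integral_dominated_convergence[where w = "\<lambda>\<theta>. B * indicator (\<Pi>\<^sub>E j\<in>K. {0..1::real}) \<theta>"])
  show "(\<lambda>\<theta>. indicator (\<Pi>\<^sub>E j\<in>K. {0..1}) \<theta> *\<^sub>R G (\<lambda>j. circ (\<theta> j)))
      \<in> borel_measurable (\<Pi>\<^sub>M j\<in>K. lborel)"
    using torus_regular_integrable[OF K G] unfolding set_integrable_def
    by (rule borel_measurable_integrable)
  show "(\<lambda>\<theta>. indicator (\<Pi>\<^sub>E j\<in>K. {0..1}) \<theta> *\<^sub>R F k (\<lambda>j. circ (\<theta> j)))
      \<in> borel_measurable (\<Pi>\<^sub>M j\<in>K. lborel)" for k
    using torus_regular_integrable[OF K F] unfolding set_integrable_def
    by (rule borel_measurable_integrable)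
  show "integrable (\<Pi>\<^sub>M j\<in>K. lborel) (\<lambda>\<theta>. B * indicator (\<Pi>\<^sub>E j\<in>K. {0..1::real}) \<theta> :: real)"
    using torus_box_sets[OF K] torus_box_emeasure[OF K]
    by (intro integrable_mult_right integrable_real_indicator) auto
  show "AE \<theta> in \<Pi>\<^sub>M j\<in>K. lborel.
      (\<lambda>k. indicator (\<Pi>\<^sub>E j\<in>K. {0..1}) \<theta> *\<^sub>R F k (\<lambda>j. circ (\<theta> j)))
        \<longlonglongrightarrow> indicator (\<Pi>\<^sub>E j\<in>K. {0..1}) \<theta> *\<^sub>R G (\<lambda>j. circ (\<theta> j))"
    by (intro AE_I2 tendsto_scaleR tendsto_const lim) simp
  show "AE \<theta> in \<Pi>\<^sub>M j\<in>K. lborel.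
      norm (indicator (\<Pi>\<^sub>E j\<in>K. {0..1}) \<theta> *\<^sub>R F k (\<lambda>j. circ (\<theta> j)))
        \<le> B * indicator (\<Pi>\<^sub>E j\<in>K. {0..1}) \<theta>" for k
    using bound by (intro AE_I2) (auto simp: indicator_def)
qed

section \<open>Cauchy's formula on the unit circle\<close>

text \<open>
  On the circle \<open>dx / (2 \<pi> \<i> x)\<close> is the angular measure, so the extra factor \<open>x\<close> turns Cauchy's integral
  formula into a statement about averages.
\<close>
lemma circle_avg_Cauchy:
  assumes g: "g holomorphic_on cball 0 1" and w: "cmod w < 1"
  shows "circle_avg (\<lambda>x. g x * x / (x - w)) = g w"
    and "set_integrable lborel {0..1} (\<lambda>y. g (circ y) * circ y / (circ y - w))"
proof -
  have ne: "circ y \<noteq> w" for y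
    using w norm_circ[of y] by auto
  have "continuous_on {0..1} (\<lambda>y. g (circ y))"
    by (rule continuous_on_compose2[OF holomorphic_on_imp_continuous_on[OF g] continuous_circ]) auto
  then have "continuous_on {0..1} (\<lambda>y. g (circ y) * circ y / (circ y - w))"
    using ne by (intro continuous_intros continuous_circ) auto
  then show int: "set_integrable lborel {0..1} (\<lambda>y. g (circ y) * circ y / (circ y - w))"
    by (rule borel_integrable_atLeastAtMost')
  have "((\<lambda>u. g u / (u - w)) has_contour_integral (2 * of_real pi * \<i> * g w)) (circlepath 0 1)"
    by (rule Cauchy_integral_circlepath_simple) (use g w in auto)
  then have "((\<lambda>y. g (circ y) / (circ y - w) * (2 * of_real pi * \<i> * circ y))
      has_integral (2 * of_real pi * \<i> * g w)) {0..1}"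
    unfolding has_contour_integral vector_derivative_circlepath
    by (simp add: circlepath circ_def)
  then have "((\<lambda>y. (1 / (2 * of_real pi * \<i>)) *
        (g (circ y) / (circ y - w) * (2 * of_real pi * \<i> * circ y)))
      has_integral (1 / (2 * of_real pi * \<i>)) * (2 * of_real pi * \<i> * g w)) {0..1}"
    by (rule has_integral_mult_right)
  then have "((\<lambda>y. g (circ y) * circ y / (circ y - w)) has_integral g w) {0..1}"
    by (simp add: field_simps)
  then show "circle_avg (\<lambda>x. g x * x / (x - w)) = g w"
    unfolding circle_avg_def set_borel_integral_eq_integral(2)[OF int]
    by (rule integral_unique)
qed

lemma circle_avg_mean_value:
  assumes "g holomorphic_on cball 0 1"
  shows "circle_avg g = g 0"
proof -
  have "circle_avg g = circle_avg (\<lambda>x. g x * x / (x - 0))"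
    by (rule circle_avg_cong) auto
  then show ?thesis
    using circle_avg_Cauchy(1)[OF assms, of 0] by simp
qed

text \<open>
  Partial fractions: \<open>c (x - d) - d (x - c) = (c - d) x\<close> turns the two factors into a combination
  of \<open>x / (x - c)\<close> and \<open>x / (x - d)\<close>, to which Cauchy's formula applies separately.
\<close>
lemma circle_avg_two_poles:
  assumes g: "g holomorphic_on cball 0 1" and c: "cmod c < 1" and d: "cmod d < 1" and "c \<noteq> d"
  shows "circle_avg (\<lambda>x. g x / ((1 - c * inverse x) * (1 - d * inverse x)))
    = c / (c - d) * g c + d / (d - c) * g d"
proof -
  have "circle_avg (\<lambda>x. g x / ((1 - c * inverse x) * (1 - d * inverse x)))
      = circle_avg (\<lambda>x. c / (c - d) * (g x * x / (x - c)) + d / (d - c) * (g x * x / (x - d)))"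
  proof (rule circle_avg_cong)
    fix x :: complex assume x: "cmod x = 1"
    have ne: "x \<noteq> 0" "x - c \<noteq> 0" "x - d \<noteq> 0" "c - d \<noteq> 0"
      using x c d \<open>c \<noteq> d\<close> by auto
    have "g x / ((1 - c * inverse x) * (1 - d * inverse x)) = g x * (x * x / ((x - c) * (x - d)))"
      using ne by (simp add: field_simps)
    also have "x * x / ((x - c) * (x - d)) = c / (c - d) * (x / (x - c)) - d / (c - d) * (x / (x - d))"
      using ne by (simp add: divide_simps) algebra
    also have "d / (c - d) = - (d / (d - c))"
      by (metis minus_diff_eq minus_divide_right)
    finally show "g x / ((1 - c * inverse x) * (1 - d * inverse x)) =
        c / (c - d) * (g x * x / (x - c)) + d / (d - c) * (g x * x / (x - d))"
      by (simp add: algebra_simps)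
  qed
  also have "\<dots> = c / (c - d) * g c + d / (d - c) * g d"
    using circle_avg_Cauchy[OF g c] circle_avg_Cauchy[OF g d]
    by (subst circle_avg_add) auto
  finally show ?thesis .
qed

section \<open>The density\<close>

definition pair_factor :: "complex \<Rightarrow> complex \<Rightarrow> complex \<Rightarrow> complex" where
  "pair_factor t x y =
     ((1 - x * y) * (1 - x * inverse y)) / ((1 - t * x * y) * (1 - t * x * inverse y))"

text \<open>
  The part of the one-variable weight without poles in the closed unit disc.
\<close>
definition analytic_weight :: "complex \<Rightarrow> complex \<Rightarrow> complex \<Rightarrow> complex \<Rightarrow> complex \<Rightarrow> complex" where
  "analytic_weight a b c d x = (1 - x\<^sup>2) / ((1 - a * x) * (1 - b * x) * (1 - c * x) * (1 - d * x))"

definition weight :: "complex \<Rightarrow> complex \<Rightarrow> complex \<Rightarrow> complex \<Rightarrow> complex \<Rightarrow> complex" where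
  "weight a b c d x =
     analytic_weight a b c d x / ((1 - c * inverse x) * (1 - d * inverse x))"

text \<open>
  The weights \<open>u i\<close> are left open because they differ between the variables that carry a positive part
  and those that carry a zero part. The variables start at index \<open>k\<close>, so that removing the first one
  gives an object of the same kind.
\<close>
definition torus_density ::
    "complex \<Rightarrow> (nat \<Rightarrow> complex \<Rightarrow> complex) \<Rightarrow> nat \<Rightarrow> nat \<Rightarrow> (nat \<Rightarrow> complex) \<Rightarrow> complex" where
  "torus_density t u k n z =
     (\<Prod>i=k..n. u i (z i) * (\<Prod>j\<in>{i<..n}. pair_factor t (z i) (z j)))"

lemma mult_small_neq_one:
  fixes s x :: complex
  assumes "cmod s < 1" "cmod x \<le> 1"
  shows "s * x \<noteq> 1"
proof
  assume "s * x = 1"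
  then have "cmod s * cmod x = 1"
    by (metis norm_mult norm_one)
  moreover have "cmod s * cmod x \<le> cmod s * 1"
    using assms by (intro mult_left_mono) auto
  ultimately show False
    using assms by simp
qed

lemma norm_mult_less_one:
  fixes s x :: complex
  assumes "cmod s < 1" "cmod x \<le> 1"
  shows "cmod (s * x) < 1"
  using assms mult_left_mono[of "cmod x" 1 "cmod s"] by (simp add: norm_mult)

lemma Delta_K_eq_density: "Delta_K n t a b c d z = torus_density t (\<lambda>_. weight a b c d) 1 n z"
proof -
  have "{(i, j). 1 \<le> i \<and> i < j \<and> j \<le> n} = (SIGMA i:{1..n}. {i<..n})"
    by auto
  then have "(\<Prod>(i, j) | 1 \<le> i \<and> i < j \<and> j \<le> n.
        ((1 - z i * z j) * (1 - z i * inverse (z j))) /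
        ((1 - t * z i * z j) * (1 - t * z i * inverse (z j))))
      = (\<Prod>i=1..n. \<Prod>j\<in>{i<..n}. pair_factor t (z i) (z j))"
    by (simp add: prod.Sigma pair_factor_def)
  then show ?thesis
    unfolding Delta_K_def torus_density_def prod.distrib
    by (simp add: weight_def analytic_weight_def mult.assoc)
qed

lemma density_split:
  assumes "k \<le> n"
  shows "torus_density t u k n (z(k := x)) =
    u k x * (\<Prod>j\<in>{k<..n}. pair_factor t x (z j)) * torus_density t u (Suc k) n z"
proof -
  have "torus_density t u (Suc k) n (z(k := x)) = torus_density t u (Suc k) n z"
    unfolding torus_density_def by (intro prod.cong arg_cong2[where f = "(*)"]) auto
  moreover have "(\<Prod>j\<in>{k<..n}. pair_factor t x ((z(k := x)) j)) = (\<Prod>j\<in>{k<..n}. pair_factor t x (z j))"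
    by (intro prod.cong) auto
  ultimately show ?thesis
    using assms by (simp add: torus_density_def prod.atLeast_Suc_atMost)
qed

lemma density_change_weights:
  "torus_density t (\<lambda>i x. u i x * v i x) k n z = torus_density t u k n z * (\<Prod>i=k..n. v i (z i))"
  by (simp add: torus_density_def prod.distrib mult_ac)

lemma analytic_weight_holomorphic:
  assumes "cmod a < 1" "cmod b < 1" "cmod c < 1" "cmod d < 1"
  shows "analytic_weight a b c d holomorphic_on cball 0 1"
  unfolding analytic_weight_def using assms
  by (intro holomorphic_intros) (auto simp: mult_small_neq_one)

lemma pair_factor_holomorphic:
  assumes "cmod t < 1" "cmod y = 1"
  shows "(\<lambda>x. pair_factor t x y) holomorphic_on cball 0 1"
  unfolding pair_factor_def using assms
  by (intro holomorphic_intros)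
     (auto simp: mult_small_neq_one norm_mult_less_one norm_inverse)

lemma weight_continuous:
  assumes "cmod a < 1" "cmod b < 1" "cmod c < 1" "cmod d < 1"
  shows "continuous_on (sphere 0 1) (weight a b c d)"
  unfolding weight_def
  by (intro continuous_intros
      continuous_on_subset[OF holomorphic_on_imp_continuous_on[OF analytic_weight_holomorphic]])
     (use assms in \<open>auto simp: mult_small_neq_one norm_inverse\<close>)

lemma pair_factor_continuous:
  assumes "cmod t < 1"
  shows "continuous_on (sphere 0 1 \<times> sphere 0 1) (\<lambda>p. pair_factor t (fst p) (snd p))"
  unfolding pair_factor_def using assms
  by (intro continuous_intros)
     (auto simp: mult_small_neq_one norm_mult_less_one norm_inverse)

lemma density_regular:
  assumes t: "cmod t < 1" and u: "\<And>i. i \<in> {k..n} \<Longrightarrow> continuous_on (sphere 0 1) (u i)"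
  shows "torus_regular {k..n} (torus_density t u k n)"
  unfolding torus_density_def
  using torus_regular_two_coordinates[OF pair_factor_continuous[OF t]]
  by (intro torus_regular_prod torus_regular_mult torus_regular_coordinate u) auto

section \<open>Integrating out the first variable\<close>

lemma torus_avg_density:
  assumes "k \<le> n" and "cmod t < 1"
    and "\<And>i. i \<in> {k..n} \<Longrightarrow> continuous_on (sphere 0 1) (u i)"
  shows "torus_avg {k..n} (torus_density t u k n) =
    torus_avg {Suc k..n} (\<lambda>z. circle_avg (\<lambda>x.
      u k x * (\<Prod>j\<in>{k<..n}. pair_factor t x (z j)) * torus_density t u (Suc k) n z))"
proof -
  have "insert k {Suc k..n} = {k..n}"
    using assms(1) by auto
  then show ?thesis
    using torus_avg_insert[of "{Suc k..n}" k "torus_density t u k n"] density_regular[of t k n u] assms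
    by (simp add: density_split)
qed

text \<open>
  By the mean value property only \<open>z k = 0\<close> counts, and there each interaction factor is \<open>1\<close>.
\<close>
lemma torus_avg_density_holomorphic:
  assumes "k \<le> n" and "cmod t < 1"
    and "\<And>i. i \<in> {k..n} \<Longrightarrow> continuous_on (sphere 0 1) (u i)"
    and "u k holomorphic_on cball 0 1" and "u k 0 = 1"
  shows "torus_avg {k..n} (torus_density t u k n) = torus_avg {Suc k..n} (torus_density t u (Suc k) n)"
proof (subst torus_avg_density[OF assms(1,2)], fact assms(3), rule torus_avg_cong)
  fix z assume z: "unimodular z"
  have "circle_avg (\<lambda>x. u k x * (\<Prod>j\<in>{k<..n}. pair_factor t x (z j)) * torus_density t u (Suc k) n z)
      = u k 0 * (\<Prod>j\<in>{k<..n}. pair_factor t 0 (z j)) * torus_density t u (Suc k) n z"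
    using assms z
    by (intro circle_avg_mean_value holomorphic_intros pair_factor_holomorphic)
       (auto simp: unimodular_def)
  then show "circle_avg (\<lambda>x. u k x * (\<Prod>j\<in>{k<..n}. pair_factor t x (z j)) * torus_density t u (Suc k) n z)
      = torus_density t u (Suc k) n z"
    by (simp add: assms(5) pair_factor_def)
qed

lemma torus_avg_density_leading_holomorphic:
  assumes "l \<le> n" and "cmod t < 1"
    and "\<And>i. i \<in> {1..n} \<Longrightarrow> continuous_on (sphere 0 1) (u i)"
    and "\<And>i. i \<in> {1..l} \<Longrightarrow> u i holomorphic_on cball 0 1"
    and "\<And>i. i \<in> {1..l} \<Longrightarrow> u i 0 = 1"
  shows "torus_avg {1..n} (torus_density t u 1 n) = torus_avg {Suc l..n} (torus_density t u (Suc l) n)"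
  using assms
proof (induction l)
  case (Suc l)
  then have "torus_avg {Suc l..n} (torus_density t u (Suc l) n)
      = torus_avg {Suc (Suc l)..n} (torus_density t u (Suc (Suc l)) n)"
    by (intro torus_avg_density_holomorphic) auto
  with Suc show ?case
    by simp
qed simp

text \<open>
  The numerator of the interaction cancels the two factors of the weight that contain \<open>c\<close>, and its
  denominator supplies the same factors with \<open>t * c\<close>.
\<close>
lemma weight_times_pair_factor:
  assumes c: "cmod c < 1" and t: "cmod t < 1" and y: "cmod y = 1"
  shows "weight a b c d y * pair_factor t c y = weight a b (t * c) d y"
proof -
  have "1 - c * y \<noteq> 0" "1 - c * inverse y \<noteq> 0"
    using c y by (auto simp: mult_small_neq_one norm_inverse)
  then show ?thesis
    by (simp add: weight_def analytic_weight_def pair_factor_def mult_ac)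
qed

lemma weight_swap: "weight a b c d = weight a b d c"
  by (simp add: weight_def analytic_weight_def fun_eq_iff mult_ac)

lemma density_weight_residue:
  assumes c: "cmod c < 1" and t: "cmod t < 1" and z: "unimodular z"
  shows "(\<Prod>j\<in>{k<..n}. pair_factor t c (z j)) * torus_density t (\<lambda>_. weight a b c d) (Suc k) n z
    = torus_density t (\<lambda>_. weight a b (t * c) d) (Suc k) n z"
proof -
  have "{k<..n} = {Suc k..n}"
    by auto
  then have "(\<Prod>j\<in>{k<..n}. pair_factor t c (z j)) * torus_density t (\<lambda>_. weight a b c d) (Suc k) n z
      = torus_density t (\<lambda>_ y. weight a b c d y * pair_factor t c y) (Suc k) n z"
    using density_change_weights[of t "\<lambda>_. weight a b c d" "\<lambda>_. pair_factor t c" "Suc k" n z]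
    by (simp add: mult.commute)
  also have "\<dots> = torus_density t (\<lambda>_. weight a b (t * c) d) (Suc k) n z"
    unfolding torus_density_def using weight_times_pair_factor[OF c t] z
    by (intro prod.cong) (auto simp: unimodular_def)
  finally show ?thesis .
qed

text \<open>
  The factor \<open>1 - x\<^sup>2\<close> cancels \<open>1 - c x\<close> at \<open>x = c\<close>.
\<close>
lemma analytic_weight_at_pole:
  assumes "cmod c < 1"
  shows "analytic_weight a b c d c = 1 / ((1 - a * c) * (1 - b * c) * (1 - c * d))"
proof -
  have "1 - c * c \<noteq> 0"
    using assms mult_small_neq_one[of c c] by auto
  then show ?thesis
    by (simp add: analytic_weight_def power2_eq_square mult_ac)
qed

lemma analytic_weight_swap: "analytic_weight a b c d = analytic_weight a b d c"
  by (simp add: analytic_weight_def fun_eq_iff mult_ac)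

text \<open>
  Each of the two poles inside the disc contributes the same kind of integral in one variable less,
  with the parameter of that pole multiplied by \<open>t\<close>.
\<close>
lemma torus_avg_density_recursion:
  assumes "k \<le> n" and t: "cmod t < 1" and abcd: "cmod a < 1" "cmod b < 1" "cmod c < 1" "cmod d < 1"
    and "c \<noteq> d"
  shows "torus_avg {k..n} (torus_density t (\<lambda>_. weight a b c d) k n) =
      c / (c - d) / ((1 - a * c) * (1 - b * c) * (1 - c * d)) *
        torus_avg {Suc k..n} (torus_density t (\<lambda>_. weight a b (t * c) d) (Suc k) n) +
      d / (d - c) / ((1 - a * d) * (1 - b * d) * (1 - c * d)) *
        torus_avg {Suc k..n} (torus_density t (\<lambda>_. weight a b c (t * d)) (Suc k) n)"
    (is "_ = ?\<alpha> * torus_avg ?K ?F + ?\<beta> * torus_avg ?K ?G")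
proof -
  let ?D = "\<lambda>z. torus_density t (\<lambda>_. weight a b c d) (Suc k) n z"
  have tc: "cmod (t * c) < 1" "cmod (t * d) < 1"
    using t abcd by (auto intro: norm_mult_less_one)
  have "torus_avg {k..n} (torus_density t (\<lambda>_. weight a b c d) k n) = torus_avg ?K (\<lambda>z. ?\<alpha> * ?F z + ?\<beta> * ?G z)"
    unfolding torus_avg_density[OF assms(1,2) weight_continuous[OF abcd]]
  proof (rule torus_avg_cong)
    fix z assume z: "unimodular z"
    define g where "g x = analytic_weight a b c d x *
      ((\<Prod>j\<in>{k<..n}. pair_factor t x (z j)) * ?D z)" for x
    have g: "g holomorphic_on cball 0 1"
      unfolding g_def using t z
      by (intro holomorphic_intros analytic_weight_holomorphic pair_factor_holomorphic abcd)
         (auto simp: unimodular_def)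
    have gc: "g c = 1 / ((1 - a * c) * (1 - b * c) * (1 - c * d)) * ?F z"
      unfolding g_def density_weight_residue[OF abcd(3) t z] analytic_weight_at_pole[OF abcd(3)] ..
    (* The pole at d is the pole at c with the roles of c and d exchanged. *)
    have "?D z = torus_density t (\<lambda>_. weight a b d c) (Suc k) n z"
      by (simp only: weight_swap[of a b c d])
    then have gd: "g d = 1 / ((1 - a * d) * (1 - b * d) * (1 - c * d)) * ?G z"
      unfolding g_def analytic_weight_swap[of a b c d]
      by (simp only: density_weight_residue[OF abcd(4) t z] analytic_weight_at_pole[OF abcd(4)]
          weight_swap[of a b "t * d" c] mult.commute[of d c])
    have "circle_avg (\<lambda>x. weight a b c d x * (\<Prod>j\<in>{k<..n}. pair_factor t x (z j)) * ?D z)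
        = circle_avg (\<lambda>x. g x / ((1 - c * inverse x) * (1 - d * inverse x)))"
      by (simp add: g_def weight_def mult_ac)
    also have "\<dots> = c / (c - d) * g c + d / (d - c) * g d"
      by (rule circle_avg_two_poles[OF g abcd(3,4) \<open>c \<noteq> d\<close>])
    also have "\<dots> = ?\<alpha> * ?F z + ?\<beta> * ?G z"
      by (simp add: gc gd)
    finally show "circle_avg (\<lambda>x. weight a b c d x * (\<Prod>j\<in>{k<..n}. pair_factor t x (z j)) * ?D z)
        = ?\<alpha> * ?F z + ?\<beta> * ?G z" .
  qed
  also have "\<dots> = ?\<alpha> * torus_avg ?K ?F + ?\<beta> * torus_avg ?K ?G"
    by (intro torus_avg_add density_regular t weight_continuous abcd tc) auto
  finally show ?thesis .
qed

text \<open>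
  The parameters \<open>D i\<close> stay in a disc of radius \<open>r < 1\<close>, so the factors that contain them are bounded on
  the torus uniformly in \<open>i\<close>, and dominated convergence applies.
\<close>
lemma torus_avg_density_tendsto:
  assumes t: "cmod t < 1" and abc: "cmod a < 1" "cmod b < 1" "cmod c < 1"
    and "r < 1" and D: "\<And>k. cmod (D k) \<le> r" and lim: "D \<longlonglongrightarrow> d"
  shows "(\<lambda>i. torus_avg {k..n} (torus_density t (\<lambda>_. weight a b c (D i)) k n))
    \<longlonglongrightarrow> torus_avg {k..n} (torus_density t (\<lambda>_. weight a b c d) k n)"
proof -
  define v :: "complex \<Rightarrow> complex \<Rightarrow> complex"
    where "v e y = 1 / ((1 - e * y) * (1 - e * inverse y))" for e y
  define F where "F = torus_density t (\<lambda>_. weight a b c 0) k n"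
  have d: "cmod d \<le> r"
    using lim D by (intro Lim_bounded[OF tendsto_norm]) auto
  (* v holds the factors that contain the last parameter, F all the others. *)
  have split: "torus_density t (\<lambda>_. weight a b c e) k n z = F z * (\<Prod>i=k..n. v e (z i))" for e z
    unfolding F_def by (subst density_change_weights[symmetric])
       (simp add: torus_density_def weight_def analytic_weight_def v_def mult_ac)
  have v_bound: "cmod (v e y) \<le> (1 / (1 - r))\<^sup>2" if "cmod e \<le> r" "cmod y = 1" for e y
  proof -
    have *: "1 - r \<le> cmod (1 - e * x)" if "cmod x = 1" for x
      using norm_triangle_ineq2[of 1 "e * x"] \<open>cmod e \<le> r\<close> that by (simp add: norm_mult)
    have "(1 - r) * (1 - r) \<le> cmod (1 - e * y) * cmod (1 - e * inverse y)"
      using *[of y] *[of "inverse y"] that \<open>r < 1\<close> by (intro mult_mono) (auto simp: norm_inverse)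
    moreover have "0 < (1 - r) * (1 - r)"
      using \<open>r < 1\<close> by simp
    ultimately show ?thesis
      by (simp add: v_def norm_divide norm_mult power2_eq_square frac_le)
  qed
  have regular: "torus_regular {k..n} (torus_density t (\<lambda>_. weight a b c e) k n)" if "cmod e \<le> r" for e
    using that \<open>r < 1\<close> by (intro density_regular t weight_continuous abc) auto
  obtain B where B: "\<And>z. unimodular z \<Longrightarrow> cmod (F z) \<le> B"
    using regular[of 0] order_trans[OF norm_ge_zero d] unfolding torus_regular_def F_def by auto
  show ?thesis
  proof (rule torus_avg_tendsto)
    fix z assume z: "unimodular z"
    have "(\<lambda>i. v (D i) y) \<longlonglongrightarrow> v d y" if "cmod y = 1" for y
      unfolding v_def using d \<open>r < 1\<close> that
      by (intro tendsto_intros lim) (auto simp: mult_small_neq_one norm_inverse)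
    then show "(\<lambda>i. torus_density t (\<lambda>_. weight a b c (D i)) k n z)
        \<longlonglongrightarrow> torus_density t (\<lambda>_. weight a b c d) k n z"
      unfolding split using z by (intro tendsto_intros) (auto simp: unimodular_def)
    fix i
    have "(\<Prod>j=k..n. cmod (v (D i) (z j))) \<le> (\<Prod>j=k..n. (1 / (1 - r))\<^sup>2)"
      using z D v_bound by (intro prod_mono) (auto simp: unimodular_def)
    then show "cmod (torus_density t (\<lambda>_. weight a b c (D i)) k n z) \<le> B * (\<Prod>j=k..n. (1 / (1 - r))\<^sup>2)"
      unfolding split norm_mult prod_norm[symmetric] using B[OF z]
      by (intro mult_mono) (auto intro: order_trans[OF norm_ge_zero] prod_nonneg)
  qed (auto intro: regular d D)
qed

section \<open>The closed form\<close>

text \<open>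
  The symbol \<open>(x; t)\<^sub>m\<close> of the theory of \<open>q\<close>-series.
\<close>
definition shifted_factorial :: "complex \<Rightarrow> complex \<Rightarrow> nat \<Rightarrow> complex" where
  "shifted_factorial t x m = (\<Prod>i<m. 1 - t ^ i * x)"

text \<open>
  For \<open>m = 0\<close> truncated subtraction makes the range of \<open>j\<close> empty, as it should be.
\<close>
definition closed_form :: "complex \<Rightarrow> complex \<Rightarrow> complex \<Rightarrow> complex \<Rightarrow> complex \<Rightarrow> nat \<Rightarrow> complex" where
  "closed_form t a b c d m =
     (\<Prod>j\<in>{m - 1..<2 * m - 1}. 1 - t ^ j * (a * b * c * d)) /
     (shifted_factorial t (a * c) m * shifted_factorial t (b * c) m * shifted_factorial t (c * d) m *
      shifted_factorial t (a * d) m * shifted_factorial t (b * d) m)"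

lemma shifted_factorial_Suc:
  "shifted_factorial t x (Suc m) = shifted_factorial t x m * (1 - t ^ m * x)"
  by (simp add: shifted_factorial_def)

lemma shifted_factorial_Suc_shift:
  "shifted_factorial t x (Suc m) = (1 - x) * shifted_factorial t (t * x) m"
  unfolding shifted_factorial_def prod.lessThan_Suc_shift by (simp add: mult_ac)

lemma norm_power_less_one_mult:
  assumes "cmod t < 1" "cmod x < 1"
  shows "cmod (t ^ i * x) < 1"
  using norm_mult_less_one[of x "t ^ i"] assms
  by (simp add: norm_power power_le_one mult.commute)

lemma shifted_factorial_nonzero:
  assumes "cmod t < 1" "cmod x < 1"
  shows "shifted_factorial t x m \<noteq> 0"
proof -
  have "1 - t ^ i * x \<noteq> 0" for i
    using norm_power_less_one_mult[OF assms, of i] by auto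
  then show ?thesis
    by (simp add: shifted_factorial_def)
qed

text \<open>
  Replacing \<open>c\<close> by \<open>t c\<close> (or \<open>d\<close> by \<open>t d\<close>) moves the exponents up by one, to a range that differs from the
  one for \<open>m + 1\<close> only by the exponent \<open>2 m\<close>.
\<close>
lemma closed_form_numerator_shift:
  "(\<Prod>j\<in>{m - 1..<2 * m - 1}. 1 - t ^ j * (t * x)) = (\<Prod>j\<in>{m..<2 * m}. 1 - t ^ j * x)"
proof (cases m)
  case (Suc k)
  have "(\<Prod>j\<in>{k..<Suc (2 * k)}. 1 - t ^ j * (t * x)) = (\<Prod>j\<in>{Suc k..<Suc (Suc (2 * k))}. 1 - t ^ j * x)"
    by (subst prod.shift_bounds_Suc_ivl) (simp add: mult_ac)
  with Suc show ?thesis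
    by simp
qed simp

text \<open>
  Over the common denominator \<open>Q\<close> both terms on the right have the numerator \<open>P\<close>, up to two factors
  each; what remains is the polynomial identity \<open>key\<close>.
\<close>
lemma closed_form_recursion:
  assumes t: "cmod t < 1" and abcd: "cmod a < 1" "cmod b < 1" "cmod c < 1" "cmod d < 1"
    and "c \<noteq> d"
  shows "closed_form t a b c d (Suc m) =
      c / (c - d) / ((1 - a * c) * (1 - b * c) * (1 - c * d)) * closed_form t a b (t * c) d m +
      d / (d - c) / ((1 - a * d) * (1 - b * d) * (1 - c * d)) * closed_form t a b c (t * d) m"
proof -
  define P where "P = (\<Prod>j\<in>{m..<2 * m}. 1 - t ^ j * (a * b * c * d))"
  define T where "T = t ^ m"
  define Q where "Q = shifted_factorial t (a * c) (Suc m) * shifted_factorial t (b * c) (Suc m) *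
    shifted_factorial t (c * d) (Suc m) * shifted_factorial t (a * d) (Suc m) *
    shifted_factorial t (b * d) (Suc m)"
  have small: "cmod (a * c) < 1" "cmod (b * c) < 1" "cmod (c * d) < 1" "cmod (a * d) < 1" "cmod (b * d) < 1"
    using abcd by (auto intro!: norm_mult_less_one)
  have ne: "1 - T * x \<noteq> 0" "1 - x \<noteq> 0" if "cmod x < 1" for x
    using norm_power_less_one_mult[OF t that, of m] that by (auto simp: T_def)
  have lhs: "closed_form t a b c d (Suc m) = P * (1 - T\<^sup>2 * (a * b * c * d)) / Q"
    by (simp add: closed_form_def P_def T_def Q_def power_mult power2_eq_square mult_2 power_add)
  have numerators:
    "(\<Prod>j\<in>{m - 1..<2 * m - 1}. 1 - t ^ j * (a * b * (t * c) * d)) = P"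
    "(\<Prod>j\<in>{m - 1..<2 * m - 1}. 1 - t ^ j * (a * b * c * (t * d))) = P"
    using closed_form_numerator_shift[of t "a * b * c * d" m] by (simp_all add: P_def mult_ac)
  have first: "closed_form t a b (t * c) d m / ((1 - a * c) * (1 - b * c) * (1 - c * d))
      = P * ((1 - T * (a * d)) * (1 - T * (b * d))) / Q"
    unfolding closed_form_def numerators Q_def
      shifted_factorial_Suc_shift[of t "a * c"] shifted_factorial_Suc_shift[of t "b * c"]
      shifted_factorial_Suc_shift[of t "c * d"] shifted_factorial_Suc[of t "a * d"]
      shifted_factorial_Suc[of t "b * d"] T_def[symmetric]
    using ne(1)[OF small(4)] ne(1)[OF small(5)] by (simp add: mult_ac)
  have second: "closed_form t a b c (t * d) m / ((1 - a * d) * (1 - b * d) * (1 - c * d))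
      = P * ((1 - T * (a * c)) * (1 - T * (b * c))) / Q"
    unfolding closed_form_def numerators Q_def
      shifted_factorial_Suc[of t "a * c"] shifted_factorial_Suc[of t "b * c"]
      shifted_factorial_Suc_shift[of t "c * d"] shifted_factorial_Suc_shift[of t "a * d"]
      shifted_factorial_Suc_shift[of t "b * d"] T_def[symmetric]
    using ne(1)[OF small(1)] ne(1)[OF small(2)] by (simp add: mult_ac)
  have key: "1 - T\<^sup>2 * (a * b * c * d) =
      c / (c - d) * ((1 - T * (a * d)) * (1 - T * (b * d))) +
      d / (d - c) * ((1 - T * (a * c)) * (1 - T * (b * c)))"
  proof -
    let ?X = "(1 - T * (a * d)) * (1 - T * (b * d))" and ?Y = "(1 - T * (a * c)) * (1 - T * (b * c))"
    have "d / (d - c) = - (d / (c - d))"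
      by (metis minus_diff_eq minus_divide_right)
    then have "c / (c - d) * ?X + d / (d - c) * ?Y = (c * ?X - d * ?Y) / (c - d)"
      by (simp add: diff_divide_distrib)
    also have "c * ?X - d * ?Y = (1 - T\<^sup>2 * (a * b * c * d)) * (c - d)"
      by algebra
    finally show ?thesis
      using \<open>c \<noteq> d\<close> by simp
  qed
  have combine: "P * (x * X + y * Y) / Q = x * (P * X / Q) + y * (P * Y / Q)" for x y X Y
    by (simp add: distrib_left add_divide_distrib mult_ac)
  have "closed_form t a b c d (Suc m) =
      c / (c - d) * (closed_form t a b (t * c) d m / ((1 - a * c) * (1 - b * c) * (1 - c * d))) +
      d / (d - c) * (closed_form t a b c (t * d) m / ((1 - a * d) * (1 - b * d) * (1 - c * d)))"
    unfolding lhs first second key by (rule combine)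
  then show ?thesis
    by simp
qed

lemma closed_form_tendsto:
  assumes t: "cmod t < 1" and abcd: "cmod a < 1" "cmod b < 1" "cmod c < 1" "cmod d < 1"
    and lim: "D \<longlonglongrightarrow> d"
  shows "(\<lambda>i. closed_form t a b c (D i) m) \<longlonglongrightarrow> closed_form t a b c d m"
proof -
  have sf: "(\<lambda>i. shifted_factorial t (x * D i) m) \<longlonglongrightarrow> shifted_factorial t (x * d) m" for x
    unfolding shifted_factorial_def by (intro tendsto_intros lim)
  show ?thesis
    unfolding closed_form_def using t abcd
    by (intro tendsto_intros lim sf)
       (auto simp: shifted_factorial_nonzero norm_mult_less_one)
qed

text \<open>
  Induction on the number \<open>m\<close> of variables, for all \<open>c\<close> and \<open>d\<close> at once because the recursion changes
  them. Even if \<open>c \<noteq> d\<close>, the pairs \<open>t c, d\<close> and \<open>c, t d\<close> may coincide, so each step has to include the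
  diagonal, as a limit of distinct pairs.
\<close>
lemma torus_avg_density_eval:
  assumes "cmod t < 1" "cmod a < 1" "cmod b < 1" "cmod c < 1" "cmod d < 1" and "k + m = Suc n"
  shows "torus_avg {k..n} (torus_density t (\<lambda>_. weight a b c d) k n) = closed_form t a b c d m"
  using assms
proof (induction m arbitrary: k c d)
  case 0
  then show ?case
    by (simp add: torus_avg_empty torus_density_def closed_form_def shifted_factorial_def)
next
  case (Suc m)
  let ?I = "\<lambda>d. torus_avg {k..n} (torus_density t (\<lambda>_. weight a b c d) k n)"
  have distinct: "?I d = closed_form t a b c d (Suc m)" if "cmod d < 1" "c \<noteq> d" for d
  proof -
    have tc: "cmod (t * c) < 1" "cmod (t * d) < 1"
      using Suc.prems that by (auto intro: norm_mult_less_one)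
    have "torus_avg {Suc k..n} (torus_density t (\<lambda>_. weight a b (t * c) d) (Suc k) n) = closed_form t a b (t * c) d m"
      "torus_avg {Suc k..n} (torus_density t (\<lambda>_. weight a b c (t * d)) (Suc k) n) = closed_form t a b c (t * d) m"
      by (rule Suc.IH; use Suc.prems that tc in simp)+
    then show ?thesis
      using Suc.prems that
      by (subst torus_avg_density_recursion) (simp_all add: closed_form_recursion)
  qed
  show ?case
  proof (cases "c = d")
    case True
    obtain r where r: "cmod d < r" "r < 1"
      using dense[OF Suc.prems(5)] by blast
    then have "d \<in> interior (ball 0 r)"
      by (simp add: interior_open)
    then have "d islimpt ball 0 r"
      by (rule interior_limit_point)
    then obtain D where D: "\<And>i. D i \<in> ball 0 r - {d}" "D \<longlonglongrightarrow> d"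
      unfolding islimpt_sequential by auto
    have D': "cmod (D i) \<le> r" "cmod (D i) < 1" "c \<noteq> D i" for i
      using D(1)[of i] r True by auto
    have "(\<lambda>i. ?I (D i)) \<longlonglongrightarrow> ?I d"
      using Suc.prems r D' D(2) by (intro torus_avg_density_tendsto[where r = r]) auto
    moreover have "(\<lambda>i. ?I (D i)) \<longlonglongrightarrow> closed_form t a b c d (Suc m)"
      unfolding distinct[OF D'(2,3)] using Suc.prems D(2) by (intro closed_form_tendsto) auto
    ultimately show ?thesis
      by (rule LIMSEQ_unique)
  next
    case False
    with Suc.prems show ?thesis
      by (intro distinct)
  qed
qed

section \<open>The inner products\<close>

lemma partition_support:
  assumes "is_partition n \<mu>"
  shows "{i \<in> {1..n}. \<mu> i > 0} = {1..part_length n \<mu>}"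
proof -
  define S where "S = {i \<in> {1..n}. \<mu> i > 0}"
  have down: "{1..i} \<subseteq> S" if "i \<in> S" for i
    using that assms unfolding S_def is_partition_def by force
  have "finite S"
    by (simp add: S_def)
  show ?thesis
  proof (cases "S = {}")
    case True
    then show ?thesis
      by (simp only: part_length_def S_def[symmetric]) simp
  next
    case False
    have "S = {1..Max S}"
      using down[OF Max_in[OF \<open>finite S\<close> False]] Max_ge[OF \<open>finite S\<close>] by (auto simp: S_def)
    then have "card S = Max S"
      by (metis card_atLeastAtMost diff_Suc_1)
    then show ?thesis
      using \<open>S = {1..Max S}\<close> by (simp only: part_length_def S_def[symmetric])
  qed
qed

text \<open>
  The conjugated arguments \<open>z\<^sup>\<mu>\<close> and \<open>E\<close> both have the form required of \<open>g\<close>; only the values of \<open>h\<close> at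
  \<open>0\<close> survive the integration, and they are \<open>1\<close> in both cases.
\<close>
lemma inner0_E_poly:
  assumes t: "cmod t < 1" and abcd: "cmod a < 1" "cmod b < 1" "cmod c < 1" "cmod d < 1"
    and \<mu>: "is_partition n \<mu>"
    and f: "f = (\<lambda>(t, a, b, c, d). E_poly n \<mu> c d)"
    and g: "\<And>z. unimodular z \<Longrightarrow> param_inv (bar_inv g) (t, a, b, c, d) z =
      (\<Prod>i | i \<in> {1..n} \<and> \<mu> i > 0. inverse (z i) ^ \<mu> i * h (z i))"
    and h: "h holomorphic_on cball 0 1" "h 0 = 1"
  shows "inner0 n (t, a, b, c, d) f g = closed_form t a b c d (zero_parts n \<mu>)"
proof -
  define l where "l = part_length n \<mu>"
  define v where "v x = h x * analytic_weight a b c d x" for x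
  define u where "u i = (if 0 < \<mu> i then v else weight a b c d)" for i
  have supp: "{i. i \<in> {1..n} \<and> \<mu> i > 0} = {1..l}"
    using partition_support[OF \<mu>] by (simp add: l_def)
  have "l \<le> n"
  proof -
    have "card {i \<in> {1..n}. \<mu> i > 0} \<le> card {1..n}"
      by (rule card_mono) auto
    then show ?thesis
      unfolding l_def part_length_def by simp
  qed
  have v: "v holomorphic_on cball 0 1" "v 0 = 1"
    unfolding v_def by (auto intro!: holomorphic_intros h analytic_weight_holomorphic abcd)
       (simp add: h analytic_weight_def)
  have v_continuous: "continuous_on (sphere 0 1) v"
    by (rule continuous_on_subset[OF holomorphic_on_imp_continuous_on[OF v(1)]]) auto
  have u_continuous: "continuous_on (sphere 0 1) (u i)" for i
    using v_continuous weight_continuous[OF abcd] by (simp add: u_def)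
  have "inner0 n (t, a, b, c, d) f g = torus_avg {1..n} (torus_density t u 1 n)"
    unfolding inner0_def torus_integral_eq_torus_avg prod.case
  proof (rule torus_avg_cong)
    fix z assume z: "unimodular z"
    let ?e = "\<lambda>i. z i ^ \<mu> i * (1 - c * inverse (z i)) * (1 - d * inverse (z i)) *
      (inverse (z i) ^ \<mu> i * h (z i))"
    have "f (t, a, b, c, d) z * param_inv (bar_inv g) (t, a, b, c, d) z
        = (\<Prod>i | i \<in> {1..n} \<and> \<mu> i > 0. ?e i)"
      by (simp add: f g[OF z] E_poly_def prod.distrib)
    also have "\<dots> = (\<Prod>i=1..n. if 0 < \<mu> i then ?e i else 1)"
      by (rule prod.inter_filter) simp
    finally have "f (t, a, b, c, d) z * param_inv (bar_inv g) (t, a, b, c, d) z *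
          Delta_K n t a b c d z
        = torus_density t (\<lambda>i _. weight a b c d (z i) * (if 0 < \<mu> i then ?e i else 1)) 1 n z"
      unfolding Delta_K_eq_density by (simp add: torus_density_def prod.distrib mult_ac)
    also have "\<dots> = torus_density t u 1 n z"
      unfolding torus_density_def
    proof (intro prod.cong arg_cong2[where f = "(*)"] refl)
      fix i
      have zi: "cmod (z i) = 1" "z i \<noteq> 0"
        using z by (auto simp: unimodular_def dest: spec[of _ i])
      then have "1 - c * inverse (z i) \<noteq> 0" "1 - d * inverse (z i) \<noteq> 0"
        "z i ^ \<mu> i * inverse (z i) ^ \<mu> i = 1"
        using abcd by (simp_all add: mult_small_neq_one norm_inverse flip: power_mult_distrib)
      then show "weight a b c d (z i) * (if 0 < \<mu> i then ?e i else 1) = u i (z i)"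
        using zi by (simp add: u_def v_def weight_def mult_ac)
    qed
    finally show "f (t, a, b, c, d) z * param_inv (bar_inv g) (t, a, b, c, d) z *
        Delta_K n t a b c d z = torus_density t u 1 n z" .
  qed
  also have "\<dots> = torus_avg {Suc l..n} (torus_density t u (Suc l) n)"
  proof (rule torus_avg_density_leading_holomorphic[OF \<open>l \<le> n\<close> t u_continuous])
    fix i assume "i \<in> {1..l}"
    then have "0 < \<mu> i"
      unfolding supp[symmetric] by simp
    then have "u i = v"
      by (simp add: u_def)
    then show "u i holomorphic_on cball 0 1" "u i 0 = 1"
      using v by auto
  qed
  also have "torus_density t u (Suc l) n = torus_density t (\<lambda>_. weight a b c d) (Suc l) n"
  proof
    fix z
    have "u i = weight a b c d" if "i \<in> {Suc l..n}" for i
    proof -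
      have "i \<notin> {1..l}" and "i \<in> {1..n}"
        using that by auto
      then show ?thesis
        unfolding supp[symmetric] by (auto simp: u_def)
    qed
    then show "torus_density t u (Suc l) n z = torus_density t (\<lambda>_. weight a b c d) (Suc l) n z"
      by (simp add: torus_density_def)
  qed
  also have "torus_avg {Suc l..n} \<dots> = closed_form t a b c d (zero_parts n \<mu>)"
    using \<open>l \<le> n\<close> t abcd by (intro torus_avg_density_eval) (auto simp: zero_parts_def l_def)
  finally show ?thesis .
qed

lemma closed_form_powi:
  "closed_form t a b c d m =
    (\<Prod>i<m. 1 / ((1 - t ^ i * a * c) * (1 - t ^ i * b * c) * (1 - t ^ i * c * d) *
                 (1 - t ^ i * a * d) * (1 - t ^ i * b * d))) *
    (\<Prod>j = int m - 1..2 * int m - 2. 1 - t powi j * a * b * c * d)"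
proof -
  have "(\<Prod>j = int m - 1..2 * int m - 2. 1 - t powi j * a * b * c * d)
      = (\<Prod>j\<in>{m - 1..<2 * m - 1}. 1 - t ^ j * (a * b * c * d))"
  proof (cases m)
    case (Suc k)
    have "{int m - 1..2 * int m - 2} = int ` {m - 1..<2 * m - 1}"
      unfolding Suc image_int_atLeastLessThan by auto
    then show ?thesis
      by (simp add: prod.reindex mult_ac)
  qed simp
  then show ?thesis
    by (simp add: closed_form_def shifted_factorial_def prod_dividef prod.distrib mult_ac)
qed

theorem theorem3p6:
  fixes n :: nat and t a b c d :: complex and \<mu> :: "nat \<Rightarrow> nat"
  defines "p \<equiv> (t, a, b, c, d)"
    and "E \<equiv> (\<lambda>(t, a, b, c, d). E_poly n \<mu> c d)"
    and "M \<equiv> (\<lambda>_. zmonom n (\<lambda>i. int (\<mu> i)))"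
    and "m \<equiv> zero_parts n \<mu>"
  assumes "n \<ge> 1"
    and "cmod t < 1" and "cmod a < 1" and "cmod b < 1" and "cmod c < 1" and "cmod d < 1"
    and "is_partition n \<mu>"
  shows "((part_length n \<mu> > 0 \<longrightarrow> c \<noteq> 0 \<and> d \<noteq> 0) \<longrightarrow> inner0 n p E E = inner0 n p E M) \<and>
    inner0 n p E M =
      (\<Prod>i<m. 1 / ((1 - t ^ i * a * c) * (1 - t ^ i * b * c) * (1 - t ^ i * c * d) *
                   (1 - t ^ i * a * d) * (1 - t ^ i * b * d))) *
      (\<Prod>j = int m - 1..2 * int m - 2. 1 - t powi j * a * b * c * d)"
proof -
  have "param_inv (bar_inv M) p z = (\<Prod>i | i \<in> {1..n} \<and> \<mu> i > 0. inverse (z i) ^ \<mu> i * 1)" for z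
  proof -
    have "param_inv (bar_inv M) p z = (\<Prod>i=1..n. if 0 < \<mu> i then inverse (z i) ^ \<mu> i else 1)"
      unfolding p_def M_def param_inv_def bar_inv_def zmonom_def prod.case
      by (intro prod.cong) auto
    also have "\<dots> = (\<Prod>i | i \<in> {1..n} \<and> \<mu> i > 0. inverse (z i) ^ \<mu> i)"
      by (rule prod.inter_filter[symmetric]) simp
    finally show ?thesis
      by simp
  qed
  then have EM: "inner0 n p E M = closed_form t a b c d m"
    unfolding p_def m_def using assms(6-)
    by (intro inner0_E_poly[where h = "\<lambda>_. 1"] E_def[THEN meta_eq_to_obj_eq]) auto
  have "param_inv (bar_inv E) p z = (\<Prod>i | i \<in> {1..n} \<and> \<mu> i > 0.
      inverse (z i) ^ \<mu> i * ((1 - inverse c * z i) * (1 - inverse d * z i)))" for z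
    unfolding p_def E_def param_inv_def bar_inv_def E_poly_def by (simp add: mult.assoc)
  then have EE: "inner0 n p E E = closed_form t a b c d m"
    unfolding p_def m_def using assms(6-)
    by (intro inner0_E_poly[where h = "\<lambda>x. (1 - inverse c * x) * (1 - inverse d * x)"]
        E_def[THEN meta_eq_to_obj_eq])
       (auto intro!: holomorphic_intros)
  show ?thesis
    using EE EM by (simp add: closed_form_powi)
qed

end
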